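(* Let $p$ be a prime, let $k\geq 1$ be an integer, and let $\beta_k(x,y)$ be the $k$-th twisted Bernoulli polynomial. Then for every $z\in\mathbb{C}_p$ with $|z-1|_p\geq 1$ the map defined by $$\mu_{k,z}(a+(p^N)) = p^{N(k-1)}\, z^a\, \beta_k(a/p^N, z^{p^N}),\qquad N\geq 0,\ 0\leq a\leq p^N-1,$$ extends to a $p$-adic measure on $\mathbb{Z}_p$. Moreover, $$y\,\beta_k(x+1,y)-\beta_k(x,y) = k\,x^{k-1}.$$
   Context: The twisted Bernoulli polynomials $\beta_k(x,y)\in\mathbb{Z}[y,1/(y-1)][x]$, $k\ge0$, are defined for $y\neq 1$ by $\dfrac{t e^{xt}}{y e^t-1}=\sum_{k=0}^\infty \dfrac{\beta_k(x,y)}{k!}t^k$. $\mathbb{C}_p$ is the completion of a fixed algebraic closure of $\mathbb{Q}_p$, with norm normalized by $|p|_p=1/p$. $(p^N)=p^N\mathbb{Z}_p$. A $p$-adic distribution on $\mathbb{Z}_p$ is a finitely additive $\mathbb{C}_p$-valued function on the compact open subsets of $\mathbb{Z}_p$; it is a $p$-adic measure if it is bounded. Convention $0^0=1$. *)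

theory Defs
  imports "HOL-Analysis.Analysis" "HOL-Computational_Algebra.Computational_Algebra"
begin

section \<open>Twisted Bernoulli polynomials\<close>

text \<open>
  \<open>twisted_bernoulli k x y\<close> is the value \<open>\<beta>\<^sub>k(x, y)\<close>, read off from
  \<open>t exp(x t) / (y exp(t) - 1)\<close> in the formal power series ring over the field in which
  \<open>x\<close> and \<open>y\<close> lie.  It is meaningful only for \<open>y \<noteq> 1\<close>, where the constant term
  \<open>y - 1\<close> of the denominator is invertible; for \<open>y = 1\<close> it is irrelevant here.
\<close>

definition twisted_bernoulli :: "nat \<Rightarrow> 'a :: field_char_0 \<Rightarrow> 'a \<Rightarrow> 'a" where
  "twisted_bernoulli k x y =
     fact k * fps_nth (fps_X * fps_exp x / (fps_const y * fps_exp 1 - 1)) k"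

lemma twisted_bernoulli_generating_function:
  fixes x y :: "'a :: field_char_0"
  assumes "y \<noteq> 1"
  shows "Abs_fps (\<lambda>k. twisted_bernoulli k x y / fact k) * (fps_const y * fps_exp 1 - 1) =
           fps_X * fps_exp x"
proof -
  let ?D = "fps_const y * fps_exp 1 - 1 :: 'a fps"
  have D: "fps_nth ?D 0 \<noteq> 0" using assms by simp
  have "Abs_fps (\<lambda>k. twisted_bernoulli k x y / fact k) = fps_X * fps_exp x / ?D"
    by (simp add: fps_eq_iff twisted_bernoulli_def)
  also have "\<dots> = fps_X * fps_exp x * inverse ?D"
    using D by (rule fps_divide_unit)
  finally show ?thesis
    using inverse_mult_eq_1[OF D] by (simp add: mult.assoc)
qed

text \<open>
  The functions of \<open>y \<noteq> 1\<close> given by elements of \<open>\<int>[y, 1/(y-1)]\<close>.  The lemma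
  \<open>twisted_bernoulli_polynomial\<close> below says that \<open>\<beta>\<^sub>k\<close> lies in \<open>\<int>[y, 1/(y-1)][x]\<close>.
\<close>

definition twisted_coeff :: "('a :: field_char_0 \<Rightarrow> 'a) \<Rightarrow> bool" where
  "twisted_coeff f \<longleftrightarrow>
     (\<exists>(P :: int poly) n. \<forall>y. y \<noteq> 1 \<longrightarrow> f y = poly (map_poly of_int P) y / (y - 1) ^ n)"

lemma poly_map_of_int_simps:
  "poly (map_poly of_int (P + Q)) y =
     poly (map_poly of_int P) y + poly (map_poly of_int Q) (y :: 'a :: field_char_0)"
  "poly (map_poly of_int (P * Q)) y =
     poly (map_poly of_int P) y * poly (map_poly of_int Q) y"
  "poly (map_poly of_int ([:-1, 1:] ^ n)) y = (y - 1) ^ n"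
proof -
  have add: "map_poly of_int (P + Q) = (map_poly of_int P + map_poly of_int Q :: 'a poly)" for P Q
    by (rule poly_eqI) (simp add: coeff_map_poly)
  have mult: "map_poly of_int (P * Q) = (map_poly of_int P * map_poly of_int Q :: 'a poly)" for P Q
    by (rule poly_eqI) (simp add: coeff_map_poly coeff_mult)
  show "poly (map_poly of_int (P + Q)) y =
     poly (map_poly of_int P) y + poly (map_poly of_int Q) y" by (simp add: add)
  show "poly (map_poly of_int (P * Q)) y =
     poly (map_poly of_int P) y * poly (map_poly of_int Q) y" by (simp add: mult)
  show "poly (map_poly of_int ([:-1, 1:] ^ n)) y = (y - 1) ^ n"
  proof (induction n)
    case (Suc n)
    then show ?case by (simp only: power_Suc mult poly_mult) (simp add: map_poly_pCons)
  qed simp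
qed

lemma twisted_coeff_add:
  assumes "twisted_coeff f" "twisted_coeff g"
  shows "twisted_coeff (\<lambda>y. f y + g y)"
proof -
  obtain P m Q n where
    P: "\<And>y. y \<noteq> 1 \<Longrightarrow> f y = poly (map_poly of_int (P :: int poly)) y / (y - 1) ^ m" and
    Q: "\<And>y. y \<noteq> 1 \<Longrightarrow> g y = poly (map_poly of_int (Q :: int poly)) y / (y - 1) ^ n"
    using assms unfolding twisted_coeff_def by metis
  have "f y + g y = poly (map_poly of_int (P * [:-1, 1:] ^ n + Q * [:-1, 1:] ^ m)) y / (y - 1) ^ (m + n)"
    if "y \<noteq> 1" for y
    unfolding poly_map_of_int_simps P[OF that] Q[OF that]
    using that by (simp add: field_simps power_add)
  then show ?thesis unfolding twisted_coeff_def by blast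
qed

lemma twisted_coeff_mult:
  assumes "twisted_coeff f" "twisted_coeff g"
  shows "twisted_coeff (\<lambda>y. f y * g y)"
proof -
  obtain P m Q n where
    P: "\<And>y. y \<noteq> 1 \<Longrightarrow> f y = poly (map_poly of_int (P :: int poly)) y / (y - 1) ^ m" and
    Q: "\<And>y. y \<noteq> 1 \<Longrightarrow> g y = poly (map_poly of_int (Q :: int poly)) y / (y - 1) ^ n"
    using assms unfolding twisted_coeff_def by metis
  have "f y * g y = poly (map_poly of_int (P * Q)) y / (y - 1) ^ (m + n)" if "y \<noteq> 1" for y
    unfolding poly_map_of_int_simps P[OF that] Q[OF that]
    by (simp add: power_add)
  then show ?thesis unfolding twisted_coeff_def by blast
qed

lemma twisted_coeff_of_int: "twisted_coeff (\<lambda>y. of_int c)"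
  unfolding twisted_coeff_def
  by (rule exI[of _ "[:c:]"], rule exI[of _ 0]) (simp add: map_poly_pCons)

lemma twisted_coeff_ident: "twisted_coeff (\<lambda>y. y)"
  unfolding twisted_coeff_def
  by (rule exI[of _ "[:0, 1:]"], rule exI[of _ 0]) (simp add: map_poly_pCons)

lemma twisted_coeff_inverse: "twisted_coeff (\<lambda>y. 1 / (y - 1))"
  unfolding twisted_coeff_def
  by (rule exI[of _ "1"], rule exI[of _ 1]) simp

lemma twisted_coeff_sum:
  assumes "finite A" "\<And>i. i \<in> A \<Longrightarrow> twisted_coeff (f i)"
  shows "twisted_coeff (\<lambda>y. \<Sum>i\<in>A. f i y)"
  using assms
proof (induction A rule: finite_induct)
  case empty
  show ?case using twisted_coeff_of_int[of 0] by simp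
next
  case (insert a A)
  then show ?case by (simp add: twisted_coeff_add)
qed

lemma twisted_coeff_cong:
  assumes "twisted_coeff f" "\<And>y. y \<noteq> 1 \<Longrightarrow> f y = g y"
  shows "twisted_coeff g"
  using assms unfolding twisted_coeff_def by metis

lemma twisted_coeff_inverse_fps:
  "twisted_coeff (\<lambda>y :: 'a :: field_char_0.
     fact n * fps_nth (inverse (fps_const y * fps_exp 1 - 1)) n)"
proof (induction n rule: less_induct)
  case (less n)
  define h :: "'a \<Rightarrow> nat \<Rightarrow> 'a" where
    "h y i = fact i * fps_nth (inverse (fps_const y * fps_exp 1 - 1)) i" for y i
  let ?r = "\<lambda>y. (of_int (if n = 0 then 1 else 0) +
      of_int (-1) * (y * (\<Sum>i<n. of_int (int (n choose i)) * h y i))) * (1 / (y - 1))"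
  have "twisted_coeff ?r"
    by (intro twisted_coeff_mult twisted_coeff_add twisted_coeff_of_int twisted_coeff_ident
        twisted_coeff_inverse twisted_coeff_sum) (use less in \<open>auto simp: h_def\<close>)
  then have "twisted_coeff (\<lambda>y. h y n)"
  proof (rule twisted_coeff_cong)
    fix y :: 'a
    assume y: "y \<noteq> 1"
    let ?D = "fps_const y * fps_exp 1 - 1 :: 'a fps"
    let ?g = "inverse ?D"
    have "fps_nth ?D 0 \<noteq> 0" using y by simp
    then have "?g * ?D = 1" by (rule inverse_mult_eq_1)
    then have "fps_const y * (?g * fps_exp 1) - ?g = 1"
      by (simp add: algebra_simps)
    then have "fps_nth (fps_const y * (?g * fps_exp 1) - ?g) n = fps_nth 1 n" by simp
    then have "y * (\<Sum>i\<le>n. fps_nth ?g i * (1 / fact (n - i))) - fps_nth ?g n = (if n = 0 then 1 else 0)"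
      by (simp add: fps_mult_nth[of ?g "fps_exp 1"] atLeast0AtMost)
    then have "fact n * (y * (\<Sum>i\<le>n. fps_nth ?g i * (1 / fact (n - i))) - fps_nth ?g n) =
        fact n * (if n = 0 then 1 else 0)" by (rule arg_cong)
    then have "y * (fact n * (\<Sum>i\<le>n. fps_nth ?g i * (1 / fact (n - i)))) - h y n =
        fact n * (if n = 0 then 1 else 0)"
      by (simp only: h_def right_diff_distrib mult.left_commute[of y])
    moreover have "fact n * (\<Sum>i\<le>n. fps_nth ?g i * (1 / fact (n - i))) =
        (\<Sum>i\<le>n. of_nat (n choose i) * h y i)"
      unfolding sum_distrib_left
    proof (rule sum.cong)
      fix i assume "i \<in> {..n}"
      then have "of_nat (n choose i) = (fact n / (fact i * fact (n - i)) :: 'a)"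
        by (simp add: binomial_fact)
      then show "fact n * (fps_nth ?g i * (1 / fact (n - i))) = of_nat (n choose i) * h y i"
        by (simp add: h_def)
    qed simp
    moreover have "(\<Sum>i\<le>n. of_nat (n choose i) * h y i) =
        (\<Sum>i<n. of_nat (n choose i) * h y i) + h y n"
      by (simp add: lessThan_Suc_atMost[symmetric])
    ultimately have "(y - 1) * h y n =
        (if n = 0 then 1 else 0) - y * (\<Sum>i<n. of_nat (n choose i) * h y i)"
      by (cases "n = 0") (simp_all add: algebra_simps)
    then have "((if n = 0 then 1 else 0) - y * (\<Sum>i<n. of_nat (n choose i) * h y i)) *
        (1 / (y - 1)) = h y n"
      using y by (metis mult.right_neutral nonzero_mult_div_cancel_left
          right_minus_eq times_divide_eq_right)
    then show "?r y = h y n" by (cases "n = 0") simp_all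
  qed
  then show ?case by (simp add: h_def)
qed

lemma twisted_bernoulli_polynomial:
  "\<exists>c :: nat \<Rightarrow> 'a :: field_char_0 \<Rightarrow> 'a. (\<forall>i. twisted_coeff (c i)) \<and>
     (\<forall>x y. y \<noteq> 1 \<longrightarrow> twisted_bernoulli k x y = (\<Sum>i<k. c i y * x ^ i))"
proof (intro exI conjI allI impI)
  define h :: "'a \<Rightarrow> nat \<Rightarrow> 'a" where
    "h y i = fact i * fps_nth (inverse (fps_const y * fps_exp 1 - 1)) i" for y i
  let ?c = "\<lambda>i y. of_int (int (k * ((k - 1) choose i))) * h y (k - 1 - i)"
  show "twisted_coeff (?c i)" for i
    unfolding h_def
    by (intro twisted_coeff_mult twisted_coeff_of_int twisted_coeff_inverse_fps)
  fix x y :: 'a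
  assume y: "y \<noteq> 1"
  let ?D = "fps_const y * fps_exp 1 - 1 :: 'a fps"
  have "fps_nth ?D 0 \<noteq> 0" using y by simp
  then have tb: "twisted_bernoulli k x y = fact k * fps_nth (fps_X * (fps_exp x * inverse ?D)) k"
    by (simp add: twisted_bernoulli_def fps_divide_unit mult.assoc)
  show "twisted_bernoulli k x y = (\<Sum>i<k. ?c i y * x ^ i)"
  proof (cases k)
    case 0
    have "twisted_bernoulli 0 x y = 0" using tb unfolding 0 by (simp only: fps_mult_nth_0 fps_X_nth) simp
    then show ?thesis by (simp only: 0) simp
  next
    case (Suc m)
    have "twisted_bernoulli k x y =
        (\<Sum>i\<le>m. fact (Suc m) * (x ^ i / fact i * fps_nth (inverse ?D) (m - i)))"
      unfolding tb unfolding Suc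
      by (simp add: fps_mult_nth[of "fps_exp x"] atLeast0AtMost sum_distrib_left del: fact_Suc)
    also have "\<dots> = (\<Sum>i\<le>m. ?c i y * x ^ i)"
      by (rule sum.cong) (auto simp: Suc h_def binomial_fact field_simps)
    finally show ?thesis by (simp add: Suc lessThan_Suc_atMost)
  qed
qed


section \<open>The field of \<open>p\<close>-adic complex numbers\<close>

definition is_subfield :: "'a :: field set \<Rightarrow> bool" where
  "is_subfield K \<longleftrightarrow> 0 \<in> K \<and> 1 \<in> K \<and>
     (\<forall>x\<in>K. \<forall>y\<in>K. x + y \<in> K \<and> x * y \<in> K) \<and> (\<forall>x\<in>K. - x \<in> K \<and> inverse x \<in> K)"

definition is_algebraic_closure :: "'a :: field set \<Rightarrow> 'a set \<Rightarrow> bool" where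
  "is_algebraic_closure K L \<longleftrightarrow> is_subfield K \<and> is_subfield L \<and> K \<subseteq> L \<and>
     (\<forall>x\<in>L. \<exists>f. f \<noteq> 0 \<and> range (coeff f) \<subseteq> K \<and> poly f x = 0) \<and>
     (\<forall>f. range (coeff f) \<subseteq> L \<and> degree f > 0 \<longrightarrow> (\<exists>x\<in>L. poly f x = 0))"

locale nonarch_abs =
  fixes nrm :: "'a :: field \<Rightarrow> real"
  assumes nrm_nonneg: "nrm x \<ge> 0"
    and nrm_eq_0_iff: "nrm x = 0 \<longleftrightarrow> x = 0"
    and nrm_mult: "nrm (x * y) = nrm x * nrm y"
    and nrm_add_le_max: "nrm (x + y) \<le> max (nrm x) (nrm y)"

definition nrm_dist :: "('a :: field \<Rightarrow> real) \<Rightarrow> 'a \<Rightarrow> 'a \<Rightarrow> real" where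
  "nrm_dist nrm x y = nrm (x - y)"

text \<open>\<open>L\<close> is a completion of its subset \<open>K\<close>; only used for subsets of one valued field.\<close>

definition is_completion :: "('a :: field \<Rightarrow> real) \<Rightarrow> 'a set \<Rightarrow> 'a set \<Rightarrow> bool" where
  "is_completion nrm K L \<longleftrightarrow> is_subfield K \<and> is_subfield L \<and> K \<subseteq> L \<and>
     Metric_space.mcomplete L (nrm_dist nrm) \<and>
     Metric_space.mtopology L (nrm_dist nrm) closure_of K = L"

text \<open>
  The whole type \<open>'a\<close>, with the absolute value \<open>nrm\<close>, is a field \<open>\<complex>\<^sub>p\<close>: it is the completion
  of \<open>Qpbar\<close>, an algebraic closure of \<open>Qp\<close>, which is the completion of \<open>\<rat>\<close>.  A nonarchimedean
  absolute value on \<open>\<rat>\<close> with \<open>nrm p = 1 / p\<close> for a prime \<open>p\<close> is the normalised \<open>p\<close>-adic one,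
  since by Bezout it is 1 on integers prime to \<open>p\<close>.  These conditions describe \<open>\<complex>\<^sub>p\<close> up to
  isometric isomorphism; \<open>Qpbar\<close> is the fixed choice of an algebraic closure.
\<close>

locale padic_complex = nonarch_abs nrm for nrm :: "'a :: field_char_0 \<Rightarrow> real" +
  fixes p :: nat and Qp Qpbar :: "'a set"
  assumes prime_p: "prime p"
    and nrm_p: "nrm (of_nat p) = 1 / real p"
    and completion_Qp: "is_completion nrm \<rat> Qp"
    and algebraic_closure_Qpbar: "is_algebraic_closure Qp Qpbar"
    and completion_Cp: "is_completion nrm Qpbar UNIV"


section \<open>Distributions and measures on \<open>\<int>\<^sub>p\<close>\<close>

definition padic_ints :: "('a :: field \<Rightarrow> real) \<Rightarrow> 'a set \<Rightarrow> 'a set" where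
  "padic_ints nrm Qp = {x \<in> Qp. nrm x \<le> 1}"

definition padic_coset :: "nat \<Rightarrow> ('a :: field \<Rightarrow> real) \<Rightarrow> 'a set \<Rightarrow> nat \<Rightarrow> nat \<Rightarrow> 'a set" where
  "padic_coset p nrm Qp a N = (\<lambda>u. of_nat a + of_nat p ^ N * u) ` padic_ints nrm Qp"

definition compact_open :: "('a :: field \<Rightarrow> real) \<Rightarrow> 'a set \<Rightarrow> 'a set \<Rightarrow> bool" where
  "compact_open nrm Qp U \<longleftrightarrow>
     compactin (Metric_space.mtopology (padic_ints nrm Qp) (nrm_dist nrm)) U \<and>
     openin (Metric_space.mtopology (padic_ints nrm Qp) (nrm_dist nrm)) U"

text \<open>
  Distributions are represented as functions on all sets; the values outside the compact open
  subsets of \<open>\<int>\<^sub>p\<close> are unconstrained and play no role.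
\<close>

definition padic_distribution ::
    "('a :: field \<Rightarrow> real) \<Rightarrow> 'a set \<Rightarrow> ('a set \<Rightarrow> 'a) \<Rightarrow> bool" where
  "padic_distribution nrm Qp \<mu> \<longleftrightarrow>
     (\<forall>U V. compact_open nrm Qp U \<and> compact_open nrm Qp V \<and> U \<inter> V = {} \<longrightarrow>
        \<mu> (U \<union> V) = \<mu> U + \<mu> V)"

definition padic_measure ::
    "('a :: field \<Rightarrow> real) \<Rightarrow> 'a set \<Rightarrow> ('a set \<Rightarrow> 'a) \<Rightarrow> bool" where
  "padic_measure nrm Qp \<mu> \<longleftrightarrow> padic_distribution nrm Qp \<mu> \<and>
     (\<exists>B. \<forall>U. compact_open nrm Qp U \<longrightarrow> nrm (\<mu> U) \<le> B)"

end

theory Submission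
  imports Defs
begin

text \<open>
  Write \<open>s = p\<^sup>N\<close> and \<open>y = z ^ s\<close>, so that the prescribed value on \<open>a + (p\<^sup>N)\<close> is
  \<open>z ^ a * s ^ (k - 1) * \<beta>\<^sub>k(a / s, y)\<close>.

  These values are additive under subdivision of a ball.  Passing to level \<open>N + d\<close>, with
  \<open>q = p\<^sup>d\<close>, this is the multiplication formula
  \<open>\<Sum>b<q. y ^ b * q ^ (k - 1) * \<beta>\<^sub>k((x + b) / q, y ^ q) = \<beta>\<^sub>k(x, y)\<close>
  (\<open>twisted_bernoulli_multiplication\<close>), in which all refinement depths \<open>d\<close> are treated at once.
  It comes from the generating function: after replacing \<open>t\<close> by \<open>q t\<close>, summing over \<open>b\<close> produces
  the geometric series \<open>\<Sum>b<q. (y e\<^sup>t) ^ b\<close>, which turns the denominator \<open>y\<^sup>q e\<^sup>q\<^sup>t - 1\<close> into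
  \<open>y e\<^sup>t - 1\<close>.

  The values are moreover bounded by 1.  The generating function gives a recursion expressing
  \<open>(y - 1) \<beta>\<^sub>n\<close> through integral multiples of \<open>y \<beta>\<^sub>i\<close> with \<open>i < n\<close> and \<open>n x ^ (n - 1)\<close>; by the
  ultrametric inequality it yields \<open>\<bar>s ^ (k - 1) * \<beta>\<^sub>k(a / s, y)\<bar> \<le> 1 / \<bar>y - 1\<bar>\<close> as soon as
  \<open>\<bar>y - 1\<bar> \<ge> 1\<close> (\<open>nrm_scaled_twisted_bernoulli_le\<close>).  This is where the hypothesis on \<open>z\<close>
  enters: raising to the power \<open>p\<close> is compatible with \<open>z \<mapsto> z - 1\<close> up to multiples of \<open>p\<close>, so that
  \<open>\<bar>y - 1\<bar> = \<bar>z - 1\<bar> ^ s\<close> (\<open>nrm_power_p_power_diff_1\<close>), which is at least 1 and also at least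
  \<open>\<bar>z\<bar> ^ a\<close> for \<open>a < s\<close>.

  Finally, any bounded family that is additive under subdivision extends to a measure
  (\<open>measure_extending_compatible_family\<close>).  By compactness, whether a point belongs to a compact
  open set \<open>U\<close> depends only on its class modulo some \<open>p\<^sup>N\<close>, so the sum of the values over the
  classes \<open>a mod p\<^sup>M\<close> with \<open>a \<in> U\<close> does not change once \<open>M \<ge> N\<close>, and this eventual value is the
  measure of \<open>U\<close>.
\<close>

section \<open>Identities for twisted Bernoulli polynomials\<close>

lemma twisted_bernoulli_series_cancel:
  fixes y :: "'a :: field_char_0"
  assumes "y \<noteq> 1" "F * (fps_const y * fps_exp 1 - 1) = G * (fps_const y * fps_exp 1 - 1)"
  shows "F = G"
proof -
  have "fps_nth (fps_const y * fps_exp 1 - 1) 0 \<noteq> 0"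
    using assms(1) by simp
  then have "fps_const y * fps_exp 1 - 1 \<noteq> (0 :: 'a fps)"
    by (metis fps_zero_nth)
  then show ?thesis using assms(2) by simp
qed

text \<open>
  Replacing \<open>x\<close> by \<open>x + 1\<close> multiplies the generating function by \<open>e\<^sup>t\<close>, so the left-hand side has
  generating function \<open>(y e\<^sup>t - 1) * (t e\<^sup>x\<^sup>t / (y e\<^sup>t - 1)) = t e\<^sup>x\<^sup>t\<close>.
\<close>
lemma twisted_bernoulli_difference_equation:
  fixes x y :: "'a :: field_char_0"
  assumes "y \<noteq> 1" "k \<ge> 1"
  shows "y * twisted_bernoulli k (x + 1) y - twisted_bernoulli k x y = of_nat k * x ^ (k - 1)"
proof -
  define B where "B x = Abs_fps (\<lambda>k. twisted_bernoulli k x y / fact k)" for x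
  let ?D = "fps_const y * fps_exp 1 - 1 :: 'a fps"
  have B: "B x * ?D = fps_X * fps_exp x" for x
    unfolding B_def by (rule twisted_bernoulli_generating_function[OF assms(1)])
  have "(fps_const y * B (x + 1) - B x) * ?D = fps_const y * (B (x + 1) * ?D) - B x * ?D"
    by (simp add: algebra_simps)
  also have "\<dots> = fps_X * fps_exp x * ?D"
    unfolding B by (simp add: fps_exp_add_mult algebra_simps)
  finally have "fps_const y * B (x + 1) - B x = fps_X * fps_exp x"
    by (rule twisted_bernoulli_series_cancel[OF assms(1)])
  then have "fps_nth (fps_const y * B (x + 1) - B x) k = fps_nth (fps_X * fps_exp x) k"
    by simp
  then have "(y * twisted_bernoulli k (x + 1) y - twisted_bernoulli k x y) / fact k =
      x ^ (k - 1) / fact (k - 1)"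
    using assms(2) by (simp add: B_def diff_divide_distrib)
  then have "y * twisted_bernoulli k (x + 1) y - twisted_bernoulli k x y =
      x ^ (k - 1) / fact (k - 1) * fact k"
    by (simp add: divide_eq_eq)
  also have "fact k = (of_nat k * fact (k - 1) :: 'a)"
    using assms(2) by (simp add: fact_reduce)
  finally show ?thesis by simp
qed

text \<open>
  Comparing coefficients after clearing the denominator determines \<open>\<beta>\<^sub>n\<close> from the earlier ones
  with \<open>y - 1\<close> as the only division; the integrality of the other coefficients is what makes the
  ultrametric estimate below possible.
\<close>
lemma twisted_bernoulli_recursion:
  fixes x y :: "'a :: field_char_0"
  assumes "y \<noteq> 1"
  shows "(y - 1) * twisted_bernoulli n x y =
    of_nat n * x ^ (n - 1) - y * (\<Sum>i<n. of_nat (n choose i) * twisted_bernoulli i x y)"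
proof (cases n)
  case 0
  have "fps_nth (fps_const y * fps_exp 1 - 1) 0 \<noteq> 0"
    using assms by simp
  then have "twisted_bernoulli 0 x y = 0"
    by (simp add: twisted_bernoulli_def fps_divide_unit del: fps_divide_nth_0)
  then show ?thesis using 0 by simp
next
  case (Suc m)
  define B where "B = Abs_fps (\<lambda>k. twisted_bernoulli k x y / fact k)"
  have "fps_const y * (B * fps_exp 1) - B = fps_X * fps_exp x"
    using twisted_bernoulli_generating_function[OF assms, of x]
    by (simp add: B_def algebra_simps)
  then have "fps_nth (fps_const y * (B * fps_exp 1) - B) n = fps_nth (fps_X * fps_exp x) n"
    by simp
  moreover have "fps_nth (B * fps_exp 1) n =
      (\<Sum>i\<le>n. twisted_bernoulli i x y / fact i * (1 / fact (n - i)))"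
    by (simp only: fps_mult_nth atLeast0AtMost) (simp add: B_def)
  ultimately have "y * (\<Sum>i\<le>n. twisted_bernoulli i x y / fact i * (1 / fact (n - i))) -
      twisted_bernoulli n x y / fact n = x ^ (n - 1) / fact (n - 1)"
    using Suc by (simp only: fps_sub_nth fps_mult_left_const_nth) (simp add: B_def)
  then have "fact n * (y * (\<Sum>i\<le>n. twisted_bernoulli i x y / fact i * (1 / fact (n - i))) -
      twisted_bernoulli n x y / fact n) = fact n * (x ^ (n - 1) / fact (n - 1))"
    by (rule arg_cong)
  then have "y * (fact n * (\<Sum>i\<le>n. twisted_bernoulli i x y / fact i * (1 / fact (n - i)))) -
      twisted_bernoulli n x y = fact n * (x ^ (n - 1) / fact (n - 1))"
    by (simp add: right_diff_distrib mult.left_commute[of y])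
  moreover have "fact n * (\<Sum>i\<le>n. twisted_bernoulli i x y / fact i * (1 / fact (n - i))) =
      (\<Sum>i\<le>n. of_nat (n choose i) * twisted_bernoulli i x y)"
    unfolding sum_distrib_left by (rule sum.cong) (auto simp: binomial_fact)
  moreover have "(\<Sum>i\<le>n. of_nat (n choose i) * twisted_bernoulli i x y) =
      (\<Sum>i<n. of_nat (n choose i) * twisted_bernoulli i x y) + twisted_bernoulli n x y"
    by (simp add: lessThan_Suc_atMost[symmetric])
  moreover have "fact n * (x ^ (n - 1) / fact (n - 1)) = of_nat n * x ^ (n - 1)"
    using Suc by (simp del: of_nat_Suc)
  ultimately show ?thesis by (simp add: algebra_simps)
qed

lemma fps_compose_scale_nth:
  "fps_nth (F oo (fps_const c * fps_X)) n = c ^ n * fps_nth F (n :: nat)"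
  for F :: "'a :: field fps"
  by (simp add: fps_compose_linear)

text \<open>
  With \<open>u = y e\<^sup>t\<close>, the generating function of the summands after \<open>t \<mapsto> q t\<close> is
  \<open>q t e\<^sup>x\<^sup>t * u ^ b / (u ^ q - 1)\<close>.  Since \<open>(u - 1) * (\<Sum>b<q. u ^ b) = u ^ q - 1\<close>, their sum
  is \<open>q t e\<^sup>x\<^sup>t / (u - 1)\<close>.
\<close>
lemma twisted_bernoulli_multiplication:
  fixes x y :: "'a :: field_char_0"
  assumes "q \<ge> 1" "y \<noteq> 1" "y ^ q \<noteq> 1"
  shows "(\<Sum>b<q. y ^ b * (of_nat q ^ k * twisted_bernoulli k ((x + of_nat b) / of_nat q) (y ^ q))) =
    of_nat q * twisted_bernoulli k x y"
proof -
  let ?E = "\<lambda>c. fps_exp c :: 'a fps"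
  define B where "B x y = Abs_fps (\<lambda>k. twisted_bernoulli k x y / fact k)" for x y :: 'a
  define t where "t = fps_const (of_nat q) * (fps_X :: 'a fps)"
  have t0: "fps_nth t 0 = 0" by (simp add: t_def)
  have q0: "of_nat q \<noteq> (0 :: 'a)" using assms(1) by simp
  have B: "B x y * (fps_const y * ?E 1 - 1) = fps_X * ?E x" if "y \<noteq> 1" for x y
    unfolding B_def by (rule twisted_bernoulli_generating_function[OF that])
  have exp_t: "?E c oo t = ?E (c * of_nat q)" for c
    by (rule fps_ext) (simp add: t_def fps_compose_scale_nth power_mult_distrib)
  define S where "S = (\<Sum>b<q. fps_const (y ^ b) * (B ((x + of_nat b) / of_nat q) (y ^ q) oo t))"
  let ?u = "fps_const y * ?E 1"
  have pow: "?u ^ b = fps_const (y ^ b) * ?E (of_nat b)" for b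
    by (simp add: power_mult_distrib fps_const_power fps_exp_power_mult)
  have Bt: "(B ((x + of_nat b) / of_nat q) (y ^ q) oo t) * (?u ^ q - 1) = t * ?E (x + of_nat b)" for b
  proof -
    have "(B ((x + of_nat b) / of_nat q) (y ^ q) * (fps_const (y ^ q) * ?E 1 - 1)) oo t =
        (fps_X * ?E ((x + of_nat b) / of_nat q)) oo t"
      unfolding B[OF assms(3)] ..
    then show ?thesis
      unfolding pow
      using q0 t0 by (simp add: fps_compose_mult_distrib fps_compose_sub_distrib exp_t)
  qed
  have "S * (?u ^ q - 1) = (\<Sum>b<q. fps_const (y ^ b) * (t * ?E (x + of_nat b)))"
    unfolding S_def sum_distrib_right mult.assoc Bt ..
  also have "\<dots> = t * ?E x * (\<Sum>b<q. ?u ^ b)"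
    unfolding sum_distrib_left pow by (rule sum.cong) (simp_all add: fps_exp_add_mult)
  finally have "S * (?u - 1) * (?u ^ q - 1) = t * ?E x * ((?u - 1) * (\<Sum>b<q. ?u ^ b))"
    by (simp add: mult_ac)
  also have "\<dots> = t * ?E x * (?u ^ q - 1)"
    by (simp only: power_diff_1_eq)
  finally have *: "S * (?u - 1) * (?u ^ q - 1) = t * ?E x * (?u ^ q - 1)" .
  have "fps_nth (?u ^ q - 1) 0 \<noteq> 0"
    using assms(3) unfolding pow by simp
  then have "?u ^ q - 1 \<noteq> 0" by (metis fps_zero_nth)
  with * have "S * (?u - 1) = t * ?E x" by simp
  also have "\<dots> = fps_const (of_nat q) * B x y * (?u - 1)"
    unfolding mult.assoc B[OF assms(2)] t_def by (simp add: mult.assoc)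
  finally have "S = fps_const (of_nat q) * B x y"
    by (rule twisted_bernoulli_series_cancel[OF assms(2)])
  then have "fps_nth S k = of_nat q * fps_nth (B x y) k" by simp
  then have "(\<Sum>b<q. y ^ b * (of_nat q ^ k * twisted_bernoulli k ((x + of_nat b) / of_nat q) (y ^ q))) / fact k =
      of_nat q * twisted_bernoulli k x y / fact k"
    by (simp add: S_def fps_sum_nth B_def t_def fps_compose_scale_nth sum_divide_distrib)
  then show ?thesis by (simp add: divide_eq_eq)
qed

section \<open>Estimates for nonarchimedean absolute values\<close>

context nonarch_abs
begin

lemma nrm_0 [simp]: "nrm 0 = 0"
  by (simp add: nrm_eq_0_iff)

lemma nrm_1 [simp]: "nrm 1 = 1"
proof -
  have "nrm 1 * nrm 1 = nrm 1 * 1" using nrm_mult[of 1 1] by simp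
  then show ?thesis by (simp add: nrm_eq_0_iff)
qed

lemma nrm_power: "nrm (x ^ n) = nrm x ^ n"
  by (induction n) (simp_all add: nrm_mult)

lemma nrm_minus [simp]: "nrm (- x) = nrm x"
proof -
  have "nrm (- 1) ^ 2 = 1" by (simp flip: nrm_power)
  then have "nrm (- 1) = 1" using nrm_nonneg[of "- 1"] by (simp add: power2_eq_1_iff)
  then show ?thesis using nrm_mult[of "- 1" x] by simp
qed

lemma nrm_diff_le_max: "nrm (x - y) \<le> max (nrm x) (nrm y)"
  using nrm_add_le_max[of x "- y"] by simp

lemma nrm_sum_le:
  assumes "\<And>i. i \<in> A \<Longrightarrow> nrm (f i) \<le> B" "0 \<le> B"
  shows "nrm (sum f A) \<le> B"
  using assms
proof (induction A rule: infinite_finite_induct)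
  case (insert a A)
  then have "nrm (f a) \<le> B" "nrm (sum f A) \<le> B" by simp_all
  then show ?case using insert.hyps nrm_add_le_max[of "f a" "sum f A"] by simp
qed simp_all

lemma nrm_of_nat_le_1: "nrm (of_nat n) \<le> 1"
  using nrm_sum_le[of "{..<n}" "\<lambda>_. 1" 1] by simp

lemma nrm_of_int_le_1: "nrm (of_int n) \<le> 1"
  by (cases n) (simp_all add: nrm_of_nat_le_1 del: of_nat_Suc)

lemma nrm_le_nrm_diff_1:
  assumes "nrm (z - 1) \<ge> 1"
  shows "nrm z \<le> nrm (z - 1)"
  using nrm_add_le_max[of "z - 1" 1] assms by simp

end

text \<open>
  The coefficients of the exponential series require characteristic zero.
\<close>
locale nonarch_abs_char_0 = nonarch_abs nrm for nrm :: "'a :: field_char_0 \<Rightarrow> real"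
begin

text \<open>
  Multiplying by \<open>s ^ n\<close> clears the denominators of \<open>x\<close>, as for \<open>x = a / s\<close>.  In the recursion for
  \<open>(y - 1) * s ^ n * \<beta>\<^sub>n\<close>, the term free of Bernoulli values keeps one factor \<open>s\<close>, and the factor
  \<open>1 / \<bar>y - 1\<bar>\<close> of the induction hypothesis absorbs the factor \<open>y\<close>, because \<open>\<bar>y\<bar> \<le> \<bar>y - 1\<bar>\<close>.
  Keeping the factor \<open>1 / \<bar>y - 1\<bar>\<close> is essential: for large \<open>z\<close> it compensates the factor \<open>z ^ a\<close>
  in the value of a ball.
\<close>
lemma nrm_scaled_twisted_bernoulli_le:
  assumes "nrm s \<le> 1" "nrm (s * x) \<le> 1" "nrm (y - 1) \<ge> 1"
  shows "nrm (s ^ n * twisted_bernoulli n x y) \<le> nrm s / nrm (y - 1)"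
proof (induction n rule: less_induct)
  case (less n)
  let ?b = "\<lambda>i. s ^ i * twisted_bernoulli i x y"
  have y1: "y \<noteq> 1" using assms(3) by auto
  have M: "nrm (y - 1) > 0" using assms(3) by linarith
  have "(y - 1) * ?b n = s ^ n * ((y - 1) * twisted_bernoulli n x y)"
    by (simp add: mult_ac)
  also have "\<dots> = s ^ n * (of_nat n * x ^ (n - 1)) -
      y * (\<Sum>i<n. s ^ n * (of_nat (n choose i) * twisted_bernoulli i x y))"
    unfolding twisted_bernoulli_recursion[OF y1]
    by (simp add: right_diff_distrib mult.left_commute[of y] sum_distrib_left)
  also have "s ^ n * (of_nat n * x ^ (n - 1)) = s * (of_nat n * (s * x) ^ (n - 1))"
    by (cases n) (simp_all add: power_mult_distrib)
  also have "(\<Sum>i<n. s ^ n * (of_nat (n choose i) * twisted_bernoulli i x y)) =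
      (\<Sum>i<n. of_nat (n choose i) * s ^ (n - i) * ?b i)"
    by (rule sum.cong) (simp_all add: mult_ac flip: power_add)
  finally have eq: "(y - 1) * ?b n = s * (of_nat n * (s * x) ^ (n - 1)) -
      y * (\<Sum>i<n. of_nat (n choose i) * s ^ (n - i) * ?b i)" .
  have "nrm (of_nat n * (s * x) ^ (n - 1)) \<le> 1"
    using assms(2) unfolding nrm_mult[of "of_nat n"] nrm_power
    by (intro mult_le_one nrm_of_nat_le_1 zero_le_power nrm_nonneg power_le_one)
  then have head: "nrm (s * (of_nat n * (s * x) ^ (n - 1))) \<le> nrm s"
    unfolding nrm_mult[of s] by (intro mult_left_le nrm_nonneg)
  have "nrm (\<Sum>i<n. of_nat (n choose i) * s ^ (n - i) * ?b i) \<le> nrm s / nrm (y - 1)"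
  proof (rule nrm_sum_le)
    fix i assume i: "i \<in> {..<n}"
    have "nrm (of_nat (n choose i) * s ^ (n - i)) \<le> 1"
      using assms(1) unfolding nrm_mult nrm_power
      by (intro mult_le_one nrm_of_nat_le_1 zero_le_power nrm_nonneg power_le_one)
    then have "nrm (of_nat (n choose i) * s ^ (n - i) * ?b i) \<le> nrm (?b i)"
      unfolding nrm_mult[of "of_nat (n choose i) * s ^ (n - i)"]
      by (intro mult_left_le_one_le nrm_nonneg)
    also have "\<dots> \<le> nrm s / nrm (y - 1)" using less i by simp
    finally show "nrm (of_nat (n choose i) * s ^ (n - i) * ?b i) \<le> nrm s / nrm (y - 1)" .
  qed (simp add: nrm_nonneg)
  then have "nrm y * nrm (\<Sum>i<n. of_nat (n choose i) * s ^ (n - i) * ?b i) \<le>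
      nrm (y - 1) * (nrm s / nrm (y - 1))"
    by (intro mult_mono nrm_le_nrm_diff_1[OF assms(3)] nrm_nonneg)
  then have tail: "nrm (y * (\<Sum>i<n. of_nat (n choose i) * s ^ (n - i) * ?b i)) \<le> nrm s"
    using M by (simp only: nrm_mult[of y]) simp
  have "nrm ((y - 1) * ?b n) \<le> nrm s"
    unfolding eq using nrm_diff_le_max head tail by (meson max.boundedI order_trans)
  then show ?case using M by (simp only: nrm_mult[of "y - 1"]) (simp add: field_simps)
qed

end

section \<open>Norms of integers and of powers in \<open>\<complex>\<^sub>p\<close>\<close>

context padic_complex
begin

sublocale nonarch_abs_char_0 nrm ..

lemma p_gt_1: "p > 1"
  using prime_p by (rule prime_gt_1_nat)

lemma nrm_p_power: "nrm (of_nat p ^ n) = 1 / real p ^ n"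
  by (simp add: nrm_power nrm_p power_one_over)

text \<open>
  If \<open>p\<close> did not divide \<open>m\<close>, a Bezout relation between the two would write 1 as a sum of two
  elements of norm less than 1 whenever \<open>\<bar>m\<bar> < 1\<close>.  Hence each factor \<open>1 / p\<close> of the norm comes from
  a factor \<open>p\<close>.
\<close>
lemma p_power_dvd_if_nrm_le:
  "nrm (of_int n) \<le> 1 / real p ^ N \<Longrightarrow> int p ^ N dvd n"
proof (induction N)
  case (Suc N)
  have "real p ^ N \<le> real p ^ Suc N" "0 < real p ^ N" using p_gt_1 by simp_all
  then have "1 / real p ^ Suc N \<le> 1 / real p ^ N" by (intro divide_left_mono) auto
  with Suc have "int p ^ N dvd n" by linarith
  then obtain m where m: "n = int p ^ N * m" by auto
  have "nrm (of_int n) = 1 / real p ^ N * nrm (of_int m)"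
    by (simp add: m nrm_mult nrm_p_power)
  with Suc.prems have "nrm (of_int m) \<le> 1 / real p"
    using p_gt_1 by (simp add: field_simps)
  moreover have p_inv: "1 / real p < 1" using p_gt_1 by simp
  ultimately have m_lt: "nrm (of_int m) < 1" by linarith
  have "int p dvd m"
  proof (rule ccontr)
    assume "\<not> int p dvd m"
    then have "coprime (int p) m"
      using prime_p by (simp add: prime_imp_coprime)
    then obtain u v where uv: "u * int p + v * m = 1"
      by (metis bezout_int coprime_iff_gcd_eq_1)
    have "nrm (of_int (u * int p)) < 1"
    proof -
      have "nrm (of_int u) * (1 / real p) \<le> 1 * (1 / real p)"
        by (intro mult_right_mono nrm_of_int_le_1) simp
      then show ?thesis using p_inv by (simp add: nrm_mult nrm_p)
    qed
    moreover have "nrm (of_int (v * m)) < 1"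
    proof -
      have "nrm (of_int v) * nrm (of_int m) \<le> nrm (of_int m)"
        by (intro mult_left_le_one_le nrm_nonneg nrm_of_int_le_1)
      then show ?thesis using m_lt by (simp add: nrm_mult)
    qed
    ultimately have "nrm (of_int (u * int p + v * m)) < 1"
      using nrm_add_le_max[of "of_int (u * int p)" "of_int (v * m)"] by simp
    then show False unfolding uv by simp
  qed
  then show ?case unfolding m by (simp add: mult.commute mult_dvd_mono)
qed simp

text \<open>
  With \<open>w = z - 1\<close>, all terms of \<open>(w + 1) ^ p - 1\<close> other than \<open>w ^ p\<close> carry a binomial coefficient
  divisible by \<open>p\<close>, and \<open>\<bar>w ^ i\<bar> \<le> \<bar>w ^ p\<bar>\<close> because \<open>\<bar>w\<bar> \<ge> 1\<close>; so \<open>w ^ p\<close> strictly dominates.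
\<close>
lemma nrm_power_p_diff_1:
  assumes "nrm (z - 1) \<ge> 1"
  shows "nrm (z ^ p - 1) = nrm (z - 1) ^ p"
proof -
  define w where "w = z - 1"
  have w: "nrm w \<ge> 1" using assms by (simp add: w_def)
  define R where "R = (\<Sum>i\<in>{0<..<p}. of_nat (p choose i) * w ^ i)"
  have "z ^ p = (w + 1) ^ p" by (simp add: w_def)
  also have "\<dots> = (\<Sum>i\<le>p. of_nat (p choose i) * w ^ i)"
    by (simp add: binomial_ring)
  also have "{..p} = insert 0 (insert p {0<..<p})" using p_gt_1 by auto
  finally have zp: "z ^ p - 1 = w ^ p + R" using p_gt_1 by (simp add: R_def)
  have "nrm R \<le> 1 / real p * nrm w ^ p"
    unfolding R_def
  proof (rule nrm_sum_le)
    fix i assume i: "i \<in> {0<..<p}"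
    then have "p dvd (p choose i)"
      using prime_p by (intro dvd_choose_prime) auto
    then obtain c where c: "p choose i = p * c" ..
    have "nrm (of_nat (p choose i)) \<le> 1 / real p"
      unfolding c of_nat_mult nrm_mult nrm_p
      using nrm_of_nat_le_1[of c] by (intro mult_left_le) auto
    moreover have "nrm w ^ i \<le> nrm w ^ p" using i w by (intro power_increasing) auto
    ultimately show "nrm (of_nat (p choose i) * w ^ i) \<le> 1 / real p * nrm w ^ p"
      unfolding nrm_mult nrm_power by (intro mult_mono) (auto simp: nrm_nonneg)
  qed (simp add: nrm_nonneg)
  also have "\<dots> < 1 * nrm w ^ p"
    using p_gt_1 w by (intro mult_strict_right_mono) auto
  finally have R: "nrm R < nrm (w ^ p)" by (simp add: nrm_power)
  have "nrm (w ^ p + R) \<le> nrm (w ^ p)"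
    using nrm_add_le_max[of "w ^ p" R] R by simp
  moreover have "nrm (w ^ p) \<le> nrm (w ^ p + R)"
    using nrm_diff_le_max[of "w ^ p + R" R] R by simp
  ultimately show ?thesis by (simp add: zp nrm_power flip: w_def)
qed

lemma nrm_power_p_power_diff_1:
  assumes "nrm (z - 1) \<ge> 1"
  shows "nrm (z ^ (p ^ N) - 1) = nrm (z - 1) ^ (p ^ N)"
proof (induction N)
  case (Suc N)
  have "nrm (z ^ (p ^ N) - 1) \<ge> 1" using assms by (simp add: Suc one_le_power)
  from nrm_power_p_diff_1[OF this] show ?case
    by (simp add: Suc flip: power_mult) (simp add: mult.commute)
qed simp

section \<open>Balls and compact open sets in \<open>\<int>\<^sub>p\<close>\<close>

lemma Rats_subset_Qp: "\<rat> \<subseteq> Qp"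
  using completion_Qp by (simp add: is_completion_def)

lemma of_int_in_padic_ints: "of_int n \<in> padic_ints nrm Qp"
  using Rats_subset_Qp nrm_of_int_le_1 by (auto simp: padic_ints_def)

lemma of_nat_in_padic_ints: "of_nat n \<in> padic_ints nrm Qp"
  using of_int_in_padic_ints[of "int n"] by simp

lemma nrm_of_nat_diff_le_iff:
  "nrm (of_nat b - of_nat a) \<le> 1 / real p ^ N \<longleftrightarrow> b mod p ^ N = a mod p ^ N"
proof
  assume "nrm (of_nat b - of_nat a) \<le> 1 / real p ^ N"
  then have "int p ^ N dvd int b - int a"
    using p_power_dvd_if_nrm_le[of "int b - int a" N] by simp
  then have "int b mod int (p ^ N) = int a mod int (p ^ N)"
    by (simp add: mod_eq_dvd_iff)
  then show "b mod p ^ N = a mod p ^ N"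
    unfolding zmod_int[symmetric] by simp
next
  assume "b mod p ^ N = a mod p ^ N"
  then have "int b mod int (p ^ N) = int a mod int (p ^ N)"
    unfolding zmod_int[symmetric] by simp
  then have "int p ^ N dvd int b - int a"
    by (simp add: mod_eq_dvd_iff)
  then obtain m where m: "int b - int a = int p ^ N * m" by auto
  have "of_nat b - of_nat a = (of_int (int b - int a) :: 'a)" by simp
  then have "nrm (of_nat b - of_nat a) = 1 / real p ^ N * nrm (of_int m)"
    by (simp add: m nrm_mult nrm_p_power)
  also have "\<dots> \<le> 1 / real p ^ N"
    by (intro mult_left_le nrm_of_int_le_1) simp
  finally show "nrm (of_nat b - of_nat a) \<le> 1 / real p ^ N" .
qed

lemma of_nat_in_padic_coset_iff:
  "of_nat b \<in> padic_coset p nrm Qp a N \<longleftrightarrow> b mod p ^ N = a mod p ^ N"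
proof
  assume "of_nat b \<in> padic_coset p nrm Qp a N"
  then obtain u where u: "nrm u \<le> 1" "of_nat b - of_nat a = of_nat p ^ N * u"
    by (auto simp: padic_coset_def padic_ints_def)
  then have "nrm (of_nat b - of_nat a) \<le> 1 / real p ^ N"
    unfolding u(2) nrm_mult nrm_p_power by (intro mult_left_le) auto
  then show "b mod p ^ N = a mod p ^ N" by (simp add: nrm_of_nat_diff_le_iff)
next
  assume "b mod p ^ N = a mod p ^ N"
  then have "int b mod int (p ^ N) = int a mod int (p ^ N)"
    unfolding zmod_int[symmetric] by simp
  then have "int p ^ N dvd int b - int a"
    by (simp add: mod_eq_dvd_iff)
  then obtain m where m: "int b - int a = int p ^ N * m" by auto
  have "of_nat b = (of_nat a + of_int (int b - int a) :: 'a)" by simp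
  also have "\<dots> = of_nat a + of_nat p ^ N * of_int m" unfolding m by simp
  finally show "of_nat b \<in> padic_coset p nrm Qp a N"
    unfolding padic_coset_def using of_int_in_padic_ints by blast
qed

lemma Metric_space_padic_ints: "Metric_space (padic_ints nrm Qp) (nrm_dist nrm)"
proof
  fix x y z
  show "0 \<le> nrm_dist nrm x y" by (simp add: nrm_dist_def nrm_nonneg)
  show "nrm_dist nrm x y = nrm_dist nrm y x"
    unfolding nrm_dist_def using nrm_minus[of "x - y"] by simp
  show "nrm_dist nrm x y = 0 \<longleftrightarrow> x = y" by (simp add: nrm_dist_def nrm_eq_0_iff)
  have "nrm ((x - y) + (y - z)) \<le> nrm (x - y) + nrm (y - z)"
    using nrm_add_le_max[of "x - y" "y - z"] nrm_nonneg[of "x - y"] nrm_nonneg[of "y - z"]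
    by linarith
  then show "nrm_dist nrm x z \<le> nrm_dist nrm x y + nrm_dist nrm y z"
    by (simp add: nrm_dist_def)
qed

text \<open>
  Finitely many balls inside \<open>U\<close> cover \<open>U\<close>, and their least radius serves for every point of \<open>U\<close>:
  in an ultrametric space every point of a ball is a centre of it.
\<close>
lemma compact_open_uniform_radius:
  assumes "compact_open nrm Qp U"
  shows "\<exists>r>0. \<forall>x\<in>U. \<forall>y\<in>padic_ints nrm Qp. nrm (x - y) < r \<longrightarrow> y \<in> U"
proof -
  interpret Z: Metric_space "padic_ints nrm Qp" "nrm_dist nrm"
    by (rule Metric_space_padic_ints)
  have comp: "compactin Z.mtopology U" and op: "openin Z.mtopology U"
    using assms by (auto simp: compact_open_def)
  have U: "U \<subseteq> padic_ints nrm Qp" using op by (simp add: Z.openin_mtopology)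
  have "\<forall>x\<in>U. \<exists>r>0. Z.mball x r \<subseteq> U" using op by (simp add: Z.openin_mtopology)
  then obtain \<rho> where \<rho>: "\<And>x. x \<in> U \<Longrightarrow> \<rho> x > 0 \<and> Z.mball x (\<rho> x) \<subseteq> U" by metis
  have "\<exists>\<F>. finite \<F> \<and> \<F> \<subseteq> (\<lambda>x. Z.mball x (\<rho> x)) ` U \<and> U \<subseteq> \<Union>\<F>"
    using comp U \<rho> by (intro compactinD) fastforce+
  then obtain \<F> where \<F>: "finite \<F>" "\<F> \<subseteq> (\<lambda>x. Z.mball x (\<rho> x)) ` U" "U \<subseteq> \<Union>\<F>"
    by blast
  obtain F where F: "F \<subseteq> U" "finite F" "\<F> = (\<lambda>x. Z.mball x (\<rho> x)) ` F"
    using finite_subset_image[OF \<F>(1,2)] by blast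
  have cover: "U \<subseteq> (\<Union>x\<in>F. Z.mball x (\<rho> x))"
    using \<F>(3) F(3) by simp
  \<comment> \<open>The extra element 1 keeps the minimum meaningful when \<open>U\<close> is empty.\<close>
  define r where "r = Min (insert 1 (\<rho> ` F))"
  have "r > 0" unfolding r_def using F(1,2) \<rho> by (subst Min_gr_iff) auto
  moreover have "y \<in> U" if "x \<in> U" "y \<in> padic_ints nrm Qp" "nrm (x - y) < r" for x y
  proof -
    obtain c where c: "c \<in> F" "x \<in> Z.mball c (\<rho> c)" using cover \<open>x \<in> U\<close> by blast
    have "r \<le> \<rho> c" unfolding r_def using F(2) c(1) by (intro Min_le) auto
    then have "nrm ((c - x) + (x - y)) < \<rho> c"
      using c that nrm_add_le_max[of "c - x" "x - y"] by (auto simp: nrm_dist_def)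
    then have "y \<in> Z.mball c (\<rho> c)"
      using c that by (auto simp: nrm_dist_def)
    then show ?thesis using \<rho> F(1) c(1) by blast
  qed
  ultimately show ?thesis by blast
qed

lemma compact_open_periodic:
  assumes "compact_open nrm Qp U"
  shows "\<exists>N. \<forall>a b. a mod p ^ N = b mod p ^ N \<longrightarrow> of_nat a \<in> U \<longrightarrow> of_nat b \<in> U"
proof -
  obtain r where r: "r > 0"
    "\<forall>x\<in>U. \<forall>y\<in>padic_ints nrm Qp. nrm (x - y) < r \<longrightarrow> y \<in> U"
    using compact_open_uniform_radius[OF assms] by blast
  have "1 / real p < 1" using p_gt_1 by simp
  then obtain N where "(1 / real p) ^ N < r" using real_arch_pow_inv[OF r(1)] by blast
  then have N: "1 / real p ^ N < r" by (simp add: power_one_over)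
  have "of_nat b \<in> U" if "a mod p ^ N = b mod p ^ N" "of_nat a \<in> U" for a b
  proof -
    have "nrm (of_nat a - of_nat b) < r"
      using that(1) nrm_of_nat_diff_le_iff[of a b N] N by linarith
    then show ?thesis using r(2) that(2) of_nat_in_padic_ints by blast
  qed
  then show ?thesis by blast
qed

section \<open>Measures from compatible values on balls\<close>

definition level_sum :: "(nat \<Rightarrow> nat \<Rightarrow> 'a) \<Rightarrow> 'a set \<Rightarrow> nat \<Rightarrow> 'a" where
  "level_sum m U N = (\<Sum>a<p ^ N. if of_nat a \<in> U then m a N else 0)"

text \<open>
  Every \<open>b < p ^ (N + d)\<close> is uniquely \<open>a + j * p ^ N\<close> with \<open>a < p ^ N\<close> and \<open>j < p ^ d\<close>, and it
  lies in \<open>U\<close> exactly when \<open>a\<close> does.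
\<close>
lemma level_sum_refine:
  assumes compat: "\<And>a. a < p ^ N \<Longrightarrow> m a N = (\<Sum>j<p ^ d. m (a + j * p ^ N) (N + d))"
    and periodic: "\<And>a b. a mod p ^ N = b mod p ^ N \<Longrightarrow> of_nat a \<in> U \<longleftrightarrow> of_nat b \<in> U"
  shows "level_sum m U (N + d) = level_sum m U N"
proof -
  let ?f = "\<lambda>b. if of_nat b \<in> U then m b (N + d) else 0"
  have shift: "(\<Sum>b\<in>{c..<c + q}. f b) = (\<Sum>a<q. f (a + c))" for f :: "nat \<Rightarrow> 'a" and c q
    using sum.shift_bounds_nat_ivl[of f 0 c q] by (simp add: atLeast0LessThan add.commute)
  have "level_sum m U (N + d) = (\<Sum>b<p ^ d * p ^ N. ?f b)"
    by (simp add: level_sum_def power_add mult.commute)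
  also have "\<dots> = (\<Sum>j<p ^ d. \<Sum>b\<in>{j * p ^ N..<j * p ^ N + p ^ N}. ?f b)"
    by (rule sum.nat_group[symmetric])
  also have "\<dots> = (\<Sum>j<p ^ d. \<Sum>a<p ^ N. ?f (a + j * p ^ N))"
    by (simp only: shift)
  also have "\<dots> = (\<Sum>a<p ^ N. \<Sum>j<p ^ d. ?f (a + j * p ^ N))"
    by (rule sum.swap)
  also have "\<dots> = level_sum m U N"
    unfolding level_sum_def
  proof (rule sum.cong)
    fix a assume a: "a \<in> {..<p ^ N}"
    have "of_nat (a + j * p ^ N) \<in> U \<longleftrightarrow> of_nat a \<in> U" for j
      by (rule periodic) simp
    then show "(\<Sum>j<p ^ d. ?f (a + j * p ^ N)) = (if of_nat a \<in> U then m a N else 0)"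
      using compat a by simp
  qed simp
  finally show ?thesis .
qed

text \<open>
  The measure of \<open>U\<close> is the eventual value of its level sums.  Additivity and the bound hold for the
  level sums at each fixed level, hence for their eventual values; on a ball the level sum at the
  level of the ball has a single term.
\<close>
lemma measure_extending_compatible_family:
  assumes compat: "\<And>a N d. a < p ^ N \<Longrightarrow> m a N = (\<Sum>j<p ^ d. m (a + j * p ^ N) (N + d))"
    and bounded: "\<And>a N. a < p ^ N \<Longrightarrow> nrm (m a N) \<le> B"
  shows "\<exists>\<mu>. padic_measure nrm Qp \<mu> \<and>
    (\<forall>N a. a < p ^ N \<longrightarrow> \<mu> (padic_coset p nrm Qp a N) = m a N)"
proof -
  define \<mu> where "\<mu> U = (THE v. \<forall>\<^sub>F N in sequentially. level_sum m U N = v)" for U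
  have \<mu>_eqI: "\<mu> U = v" if "\<forall>\<^sub>F N in sequentially. level_sum m U N = v" for U v
    unfolding \<mu>_def
  proof (rule the_equality)
    fix w assume "\<forall>\<^sub>F N in sequentially. level_sum m U N = w"
    with that have "\<forall>\<^sub>F N in sequentially. w = v" by eventually_elim simp
    then show "w = v" by simp
  qed (rule that)
  have stable: "\<forall>\<^sub>F M in sequentially. level_sum m U M = level_sum m U N"
    if "\<And>a b. a mod p ^ N = b mod p ^ N \<Longrightarrow> of_nat a \<in> U \<longleftrightarrow> of_nat b \<in> U" for U N
    using eventually_ge_at_top[of N]
  proof eventually_elim
    case (elim M)
    have "level_sum m U (N + (M - N)) = level_sum m U N"
      by (rule level_sum_refine) (fact compat, fact that)
    with elim show ?case by simp
  qed
  have \<mu>_level: "\<forall>\<^sub>F N in sequentially. level_sum m U N = \<mu> U"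
    if co: "compact_open nrm Qp U" for U
  proof -
    obtain N where N: "\<forall>a b. a mod p ^ N = b mod p ^ N \<longrightarrow> of_nat a \<in> U \<longrightarrow> of_nat b \<in> U"
      using compact_open_periodic[OF co] by blast
    have "\<forall>\<^sub>F M in sequentially. level_sum m U M = level_sum m U N"
      using N by (intro stable) metis
    moreover from this have "\<mu> U = level_sum m U N" by (rule \<mu>_eqI)
    ultimately show ?thesis by simp
  qed
  have "0 \<le> B" using bounded[of 0 0] nrm_nonneg[of "m 0 0"] by simp
  then have level_le: "nrm (level_sum m U N) \<le> B" for U N
    unfolding level_sum_def by (intro nrm_sum_le) (auto simp: bounded)
  have "padic_distribution nrm Qp \<mu>"
    unfolding padic_distribution_def
  proof (intro allI impI, elim conjE)
    fix U V assume U: "compact_open nrm Qp U" and V: "compact_open nrm Qp V" and "U \<inter> V = {}"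
    then have split: "level_sum m (U \<union> V) N = level_sum m U N + level_sum m V N" for N
      unfolding level_sum_def sum.distrib[symmetric] by (intro sum.cong) auto
    show "\<mu> (U \<union> V) = \<mu> U + \<mu> V"
      using \<mu>_level[OF U] \<mu>_level[OF V]
      by (intro \<mu>_eqI, eventually_elim) (simp add: split)
  qed
  moreover have "nrm (\<mu> U) \<le> B" if "compact_open nrm Qp U" for U
    using eventually_happens'[OF sequentially_bot \<mu>_level[OF that]] level_le by metis
  ultimately have "padic_measure nrm Qp \<mu>"
    unfolding padic_measure_def by blast
  moreover have "\<mu> (padic_coset p nrm Qp a N) = m a N" if a: "a < p ^ N" for a N
  proof -
    let ?C = "padic_coset p nrm Qp a N"
    have "level_sum m ?C N = (\<Sum>b<p ^ N. if b = a then m b N else 0)"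
      unfolding level_sum_def using a by (intro sum.cong) (simp_all add: of_nat_in_padic_coset_iff)
    also have "\<dots> = m a N" using a by simp
    finally have "level_sum m ?C N = m a N" .
    moreover have "\<forall>\<^sub>F M in sequentially. level_sum m ?C M = level_sum m ?C N"
      by (rule stable) (simp add: of_nat_in_padic_coset_iff)
    ultimately show ?thesis by (intro \<mu>_eqI) simp
  qed
  ultimately show ?thesis by blast
qed

section \<open>The twisted Bernoulli measure\<close>

definition twisted_ball_value :: "nat \<Rightarrow> 'a \<Rightarrow> nat \<Rightarrow> nat \<Rightarrow> 'a" where
  "twisted_ball_value k z a N = of_nat p ^ (N * (k - 1)) * z ^ a *
     twisted_bernoulli k (of_nat a / of_nat p ^ N) (z ^ (p ^ N))"

lemma power_p_power_neq_1:
  assumes "nrm (z - 1) \<ge> 1"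
  shows "z ^ (p ^ N) \<noteq> 1"
proof
  assume "z ^ (p ^ N) = 1"
  then show False
    using nrm_power_p_power_diff_1[OF assms, of N] assms by auto
qed

text \<open>
  The multiplication formula for \<open>x = a / p\<^sup>N\<close>, \<open>y = z ^ p\<^sup>N\<close> and \<open>q = p\<^sup>d\<close>: the argument
  \<open>(a + j p\<^sup>N) / p\<^sup>N\<^sup>+\<^sup>d\<close> is \<open>(x + j) / q\<close>, and \<open>z ^ (j p\<^sup>N) = y ^ j\<close>.
\<close>
lemma twisted_ball_value_compatible:
  assumes z: "nrm (z - 1) \<ge> 1" and k: "k \<ge> 1"
  shows "twisted_ball_value k z a N =
    (\<Sum>j<p ^ d. twisted_ball_value k z (a + j * p ^ N) (N + d))"
proof -
  define P where "P = (of_nat p :: 'a)"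
  define x where "x = of_nat a / P ^ N"
  define y where "y = z ^ (p ^ N)"
  have P0: "P \<noteq> 0" using p_gt_1 by (simp add: P_def)
  obtain l where l: "k = Suc l" using k by (cases k) auto
  have yq: "y ^ (p ^ d) = z ^ (p ^ (N + d))" by (simp add: y_def power_add power_mult)
  have mult: "(\<Sum>b<p ^ d. y ^ b * ((P ^ d) ^ k *
        twisted_bernoulli k ((x + of_nat b) / P ^ d) (y ^ (p ^ d)))) =
      P ^ d * twisted_bernoulli k x y"
    using twisted_bernoulli_multiplication[of "p ^ d" y k x] p_gt_1
      power_p_power_neq_1[OF z, of N] power_p_power_neq_1[OF z, of "N + d"]
    by (simp add: P_def yq) (simp add: y_def)
  \<comment> \<open>The extra factor \<open>P ^ d\<close> makes the exponent of \<open>P ^ d\<close> equal to \<open>k\<close>, as in the multiplication formula.\<close>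
  have "P ^ d * (\<Sum>j<p ^ d. twisted_ball_value k z (a + j * p ^ N) (N + d)) =
      P ^ (N * l) * z ^ a * (\<Sum>b<p ^ d. y ^ b * ((P ^ d) ^ k *
        twisted_bernoulli k ((x + of_nat b) / P ^ d) (y ^ (p ^ d))))"
    unfolding sum_distrib_left
  proof (rule sum.cong)
    fix j
    have arg: "of_nat (a + j * p ^ N) / P ^ (N + d) = (x + of_nat j) / P ^ d"
      using P0 by (simp add: x_def P_def field_simps power_add)
    have "z ^ (a + j * p ^ N) = z ^ a * y ^ j"
      by (simp add: y_def power_add mult.commute[of j] power_mult)
    moreover have "P ^ d * P ^ ((N + d) * l) = P ^ (N * l) * (P ^ d) ^ k"
      by (simp add: l power_add add_mult_distrib power_mult)
    ultimately show "P ^ d * twisted_ball_value k z (a + j * p ^ N) (N + d) =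
        P ^ (N * l) * z ^ a * (y ^ j * ((P ^ d) ^ k *
          twisted_bernoulli k ((x + of_nat j) / P ^ d) (y ^ (p ^ d))))"
      unfolding twisted_ball_value_def P_def[symmetric] arg yq
      by (simp add: l mult_ac del: power_Suc)
  qed simp
  also have "\<dots> = P ^ d * twisted_ball_value k z a N"
    unfolding mult by (simp add: twisted_ball_value_def l x_def y_def P_def)
  finally show ?thesis using P0 by simp
qed

text \<open>
  Since \<open>a < p\<^sup>N\<close>, the factor \<open>z ^ a\<close> is bounded by \<open>\<bar>z - 1\<bar> ^ p\<^sup>N = \<bar>z ^ p\<^sup>N - 1\<bar>\<close>, which
  cancels against the bound for the Bernoulli factor.
\<close>
lemma nrm_twisted_ball_value_le_1:
  assumes z: "nrm (z - 1) \<ge> 1" and k: "k \<ge> 1" and a: "a < p ^ N"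
  shows "nrm (twisted_ball_value k z a N) \<le> 1"
proof -
  define s where "s = (of_nat p ^ N :: 'a)"
  define y where "y = z ^ (p ^ N)"
  define \<beta> where "\<beta> = twisted_bernoulli k (of_nat a / s) y"
  have s: "s \<noteq> 0" "0 < nrm s" "nrm s \<le> 1"
    using p_gt_1 by (simp_all add: s_def nrm_p_power)
  have M: "nrm (y - 1) = nrm (z - 1) ^ (p ^ N)"
    unfolding y_def by (rule nrm_power_p_power_diff_1[OF z])
  then have M1: "nrm (y - 1) \<ge> 1" using z by simp
  have "nrm (s ^ k * \<beta>) \<le> nrm s / nrm (y - 1)"
    unfolding \<beta>_def using s M1 nrm_of_nat_le_1 by (intro nrm_scaled_twisted_bernoulli_le) auto
  moreover have "s ^ k * \<beta> = s * (s ^ (k - 1) * \<beta>)"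
    using k by (cases k) simp_all
  ultimately have "nrm s * nrm (s ^ (k - 1) * \<beta>) \<le> nrm s * (1 / nrm (y - 1))"
    by (simp add: nrm_mult)
  then have bernoulli: "nrm (s ^ (k - 1) * \<beta>) \<le> 1 / nrm (y - 1)"
    using s(2) by (rule mult_left_le_imp_le)
  have "nrm z ^ a \<le> nrm (z - 1) ^ a"
    by (intro power_mono nrm_le_nrm_diff_1[OF z] nrm_nonneg)
  also have "\<dots> \<le> nrm (y - 1)"
    unfolding M using z a by (intro power_increasing) auto
  finally have "nrm (z ^ a) \<le> nrm (y - 1)" by (simp add: nrm_power)
  then have "nrm (z ^ a) * nrm (s ^ (k - 1) * \<beta>) \<le> nrm (y - 1) * (1 / nrm (y - 1))"
    using bernoulli by (intro mult_mono) (auto simp: nrm_nonneg)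
  also have "\<dots> = 1" using M1 by simp
  finally have "nrm (z ^ a * (s ^ (k - 1) * \<beta>)) \<le> 1" by (simp add: nrm_mult)
  moreover have "twisted_ball_value k z a N = z ^ a * (s ^ (k - 1) * \<beta>)"
    by (simp add: twisted_ball_value_def \<beta>_def s_def y_def power_mult mult_ac)
  ultimately show ?thesis by simp
qed

end

theorem theorem3:
  fixes nrm :: "'a :: field_char_0 \<Rightarrow> real" and p k :: nat and Qp Qpbar :: "'a set"
  assumes "prime p"
    and "padic_complex nrm p Qp Qpbar"
    and "k \<ge> 1"
  shows "(\<forall>z :: 'a. nrm (z - 1) \<ge> 1 \<longrightarrow>
            (\<exists>\<mu> :: 'a set \<Rightarrow> 'a. padic_measure nrm Qp \<mu> \<and>
               (\<forall>N a. a \<le> p ^ N - 1 \<longrightarrow>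
                  \<mu> (padic_coset p nrm Qp a N) =
                    of_nat p ^ (N * (k - 1)) * z ^ a *
                      twisted_bernoulli k (of_nat a / of_nat p ^ N) (z ^ (p ^ N)))))
       \<and> (\<forall>x y :: 'b :: field_char_0. y \<noteq> 1 \<longrightarrow>
            y * twisted_bernoulli k (x + 1) y - twisted_bernoulli k x y =
              of_nat k * x ^ (k - 1))"
proof -
  interpret padic_complex nrm p Qp Qpbar by fact
  have "\<exists>\<mu>. padic_measure nrm Qp \<mu> \<and>
      (\<forall>N a. a \<le> p ^ N - 1 \<longrightarrow> \<mu> (padic_coset p nrm Qp a N) = twisted_ball_value k z a N)"
    if z: "nrm (z - 1) \<ge> 1" for z
  proof -
    have "a < p ^ N" if "a \<le> p ^ N - 1" for a N
    proof -
      have "0 < p ^ N" using p_gt_1 by simp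
      then show ?thesis using that by linarith
    qed
    then show ?thesis
      using measure_extending_compatible_family[of "twisted_ball_value k z" 1,
          OF twisted_ball_value_compatible[OF z assms(3)]
            nrm_twisted_ball_value_le_1[OF z assms(3)]]
      by blast
  qed
  then show ?thesis
    unfolding twisted_ball_value_def
    using twisted_bernoulli_difference_equation assms(3) by blast
qed

end
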